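(* Let $n\ge1$ and $\chi=(h_1,\dots,h_n)\in\{\ell,r\}^n$. Let $\sigma_\chi$ be the permutation of $\{1,\dots,n\}$ associated to $\chi$, and let $\mathcal P^{(\chi)}(n)$ be the set of output-time partitions of deque-scenarios compatible with $\chi$. Then $$\mathcal P^{(\chi)}(n)=\{\sigma_\chi\cdot\pi : \pi\in NC(n)\}.$$
   Context: **Partitions.** $NC(n)$ is the set of non-crossing partitions of $\{1,\dots,n\}$ (there are no two distinct blocks $V,W$ and $a<b<c<d$ with $a,c\in V$, $b,d\in W$). For a permutation $\tau$ of $\{1,\dots,n\}$ and a partition $\pi=\{V_1,\dots,V_k\}$, $\tau\cdot\pi:=\{\tau(V_1),\dots,\tau(V_k)\}$. **The permutation $\sigma_\chi$.** Let $m_\ell(1)<\cdots<m_\ell(u)$ be the elements of $\{m:h_m=\ell\}$ and $m_r(1)<\cdots<m_r(v)$ those of $\{m:h_m=r\}$ ($u+v=n$, $u=0$ or $v=0$ allowed). Then $\sigma_\chi(q)=m_\ell(q)$ for $1\le q\le u$ and $\sigma_\chi(q)=m_r(n+1-q)$ for $u+1\le q\le n$; i.e. in two-line notation the second row is $m_\ell(1),\dots,m_\ell(u),m_r(v),\dots,m_r(1)$. **Lukasiewicz paths.** $\mathrm{Luk}(n)$ is the set of lattice paths $\lambda=((0,0),(1,j_1),\dots,(n,j_n))$ with all steps of the form $(1,i)$, $i\in\{-1,0,1,2,\dots\}$, with $j_m\ge0$ for all $m$ and $j_n=0$. The rise-vector of $\lambda$ is $(j_1,j_2-j_1,\dots,j_n-j_{n-1})$;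 it determines $\lambda$. **Output-time partitions.** Let $\lambda\in\mathrm{Luk}(n)$ have rise-vector $(p_1-1,\dots,p_n-1)$ with $p_i\in\{0,1,2,\dots\}$, and let $\chi=(h_1,\dots,h_n)\in\{\ell,r\}^n$. Consider $n$ balls labelled $1,\dots,n$ and a horizontal row (the deque), initially empty. For $i=1,\dots,n$ the $i$-th move is: insert the $p_i$ balls with labels $p_1+\cdots+p_{i-1}+1,\dots,p_1+\cdots+p_i$ one at a time, in increasing order of labels, at the left end of the deque if $h_i=\ell$, at the right end if $h_i=r$; then remove from the deque its leftmost ball if $h_i=\ell$, its rightmost ball if $h_i=r$; the removed ball has output time $i$. For each $i$ with $p_i>0$ let $T_i$ be the set of output times of the $p_i$ balls inserted in the $i$-th move. The output-time partition associated to $(\lambda,\chi)$ is $\Phi_\chi(\lambda):=\{T_i: 1\le i\le n,\ p_i>0\}$, a partition of $\{1,\dots,n\}$. Define $\mathcal P^{(\chi)}(n):=\{\Phi_\chi(\lambda):\lambda\in\mathrm{Luk}(n)\}$. *)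

theory Defs
  imports Main "HOL-Library.Disjoint_Sets"
begin

definition NC :: "nat \<Rightarrow> nat set set set" where
  "NC n = {\<pi>. partition_on {1..n} \<pi> \<and>
     \<not> (\<exists>V\<in>\<pi>. \<exists>W\<in>\<pi>. V \<noteq> W \<and>
          (\<exists>a b c d. a < b \<and> b < c \<and> c < d \<and> a \<in> V \<and> c \<in> V \<and> b \<in> W \<and> d \<in> W))}"

definition act :: "(nat \<Rightarrow> nat) \<Rightarrow> nat set set \<Rightarrow> nat set set" where
  "act \<tau> \<pi> = (\<lambda>V. \<tau> ` V) ` \<pi>"

(* chi = (h_1,...,h_n) is a list of length n. Moves, positions and output times
   are counted from 1, while list indices start at 0, so h_i is chi ! (i - 1). *)

datatype side = Left_end | Right_end

definition positions :: "side \<Rightarrow> side list \<Rightarrow> nat list" where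
  "positions s \<chi> = sorted_list_of_set {m \<in> {1..length \<chi>}. \<chi> ! (m - 1) = s}"

(* m_l(q) is positions Left_end chi ! (q - 1), and m_r(n + 1 - q) is
   positions Right_end chi ! (n - q). Outside {1..n} the map is the identity. *)
definition sigma :: "side list \<Rightarrow> nat \<Rightarrow> nat" where
  "sigma \<chi> q =
     (let n = length \<chi>; u = length (positions Left_end \<chi>)
      in if 1 \<le> q \<and> q \<le> u then positions Left_end \<chi> ! (q - 1)
         else if u + 1 \<le> q \<and> q \<le> n then positions Right_end \<chi> ! (n - q)
         else q)"

definition Luk :: "nat \<Rightarrow> (int \<times> int) list set" where
  "Luk n = {lam. length lam = n + 1 \<and> lam ! 0 = (0, 0) \<and>
     (\<forall>m<n. \<exists>i\<ge>-1. lam ! (m + 1) = (fst (lam ! m) + 1, snd (lam ! m) + i)) \<and>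
     (\<forall>m\<le>n. snd (lam ! m) \<ge> 0) \<and> snd (lam ! n) = 0}"

definition rise_vector :: "(int \<times> int) list \<Rightarrow> int list" where
  "rise_vector lam = map (\<lambda>m. snd (lam ! (m + 1)) - snd (lam ! m)) [0..<length lam - 1]"

(* The list (p_1,...,p_n), where (p_1 - 1,...,p_n - 1) is the rise-vector. *)
definition insertions :: "(int \<times> int) list \<Rightarrow> nat list" where
  "insertions lam = map (\<lambda>r. nat (r + 1)) (rise_vector lam)"

(* The labels p_1 + ... + p_(i-1) + 1, ..., p_1 + ... + p_i, in increasing order. *)
definition labels :: "nat list \<Rightarrow> nat \<Rightarrow> nat list" where
  "labels p i = [sum_list (take (i - 1) p) + 1 ..< sum_list (take i p) + 1]"

(* A deque is the list of the labels of its balls, read from left to right. *)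

fun insert_ball :: "side \<Rightarrow> nat \<Rightarrow> nat list \<Rightarrow> nat list" where
  "insert_ball Left_end b d = b # d"
| "insert_ball Right_end b d = d @ [b]"

fun end_ball :: "side \<Rightarrow> nat list \<Rightarrow> nat" where
  "end_ball Left_end d = hd d"
| "end_ball Right_end d = last d"

fun remove_end :: "side \<Rightarrow> nat list \<Rightarrow> nat list" where
  "remove_end Left_end d = tl d"
| "remove_end Right_end d = butlast d"

definition insert_phase :: "side list \<Rightarrow> nat list \<Rightarrow> nat \<Rightarrow> nat list \<Rightarrow> nat list" where
  "insert_phase \<chi> p i d = fold (insert_ball (\<chi> ! (i - 1))) (labels p i) d"

(* The deque after the first i moves. *)
primrec deque :: "side list \<Rightarrow> nat list \<Rightarrow> nat \<Rightarrow> nat list" where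
  "deque \<chi> p 0 = []"
| "deque \<chi> p (Suc i) = remove_end (\<chi> ! i) (insert_phase \<chi> p (Suc i) (deque \<chi> p i))"

(* The ball removed in the i-th move, i >= 1. For p = insertions lam with lam in Luk n
   and i <= n, the deque is nonempty at that moment, because p_1 + ... + p_i >= i. *)
definition removed_ball :: "side list \<Rightarrow> nat list \<Rightarrow> nat \<Rightarrow> nat" where
  "removed_ball \<chi> p i = end_ball (\<chi> ! (i - 1)) (insert_phase \<chi> p i (deque \<chi> p (i - 1)))"

definition has_output_time :: "side list \<Rightarrow> nat list \<Rightarrow> nat \<Rightarrow> nat \<Rightarrow> bool" where
  "has_output_time \<chi> p b t \<longleftrightarrow> t \<in> {1..length \<chi>} \<and> removed_ball \<chi> p t = b"

definition output_block :: "side list \<Rightarrow> nat list \<Rightarrow> nat \<Rightarrow> nat set" where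
  "output_block \<chi> p i = {t. \<exists>b \<in> set (labels p i). has_output_time \<chi> p b t}"

definition Phi :: "side list \<Rightarrow> (int \<times> int) list \<Rightarrow> nat set set" where
  "Phi \<chi> lam =
     (let p = insertions lam
      in {output_block \<chi> p i | i. 1 \<le> i \<and> i \<le> length \<chi> \<and> p ! (i - 1) > 0})"

definition output_time_partitions :: "side list \<Rightarrow> nat set set set" where
  "output_time_partitions \<chi> = {Phi \<chi> lam | lam. lam \<in> Luk (length \<chi>)}"

end

theory Submission
  imports Defs
begin

text \<open>Call the inverse image of a time under sigma its rank. The time i has the smallest rank
  among all times from i on if the i-th move is on the left, and the largest rank if it is on the
  right; therefore, reading the deque from left to right, the future output times of its balls have
  increasing rank. When the block with minimum i is inserted on the left (right), all its ranks must
  thus lie below (above) the ranks of the times after i in the blocks with smaller minimum. A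
  partition has this separation property exactly when it has no crossing with respect to the rank,
  and conversely every partition with this property arises by inserting at each move i as many
  balls as the block with minimum i has elements, which runs the deque in rank order.\<close>

subsection \<open>Ranks and separated partitions\<close>

definition rank :: "side list \<Rightarrow> nat \<Rightarrow> nat" where
  "rank \<chi> = inv_into {1..length \<chi>} (sigma \<chi>)"

section \<open>Bijectivity of \<open>sigma\<close> and comparison of ranks\<close>

lemma set_positions: "set (positions s \<chi>) = {m \<in> {1..length \<chi>}. \<chi> ! (m - 1) = s}"
  by (simp add: positions_def)

lemma sorted_positions: "sorted_wrt (<) (positions s \<chi>)"
  unfolding positions_def by (rule strict_sorted_list_of_set)

lemma length_positions_add:
  "length (positions Left_end \<chi>) + length (positions Right_end \<chi>) = length \<chi>"
proof -
  have "{1..length \<chi>} = {m \<in> {1..length \<chi>}. \<chi> ! (m - 1) = Left_end} \<union>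
      {m \<in> {1..length \<chi>}. \<chi> ! (m - 1) = Right_end}" (is "?A = ?B")
  proof (rule set_eqI)
    show "x \<in> ?A \<longleftrightarrow> x \<in> ?B" for x by (cases "\<chi> ! (x - 1)") simp_all
  qed
  then have "card {1..length \<chi>} = card ?B" by (rule arg_cong)
  also have "\<dots> = length (positions Left_end \<chi>) + length (positions Right_end \<chi>)"
    by (subst card_Un_disjoint) (auto simp: positions_def)
  finally show ?thesis by simp
qed

lemma sigma_left:
  "1 \<le> q \<Longrightarrow> q \<le> length (positions Left_end \<chi>) \<Longrightarrow>
    sigma \<chi> q = positions Left_end \<chi> ! (q - 1)"
  by (simp add: sigma_def Let_def)

lemma sigma_right:
  "length (positions Left_end \<chi>) < q \<Longrightarrow> q \<le> length \<chi> \<Longrightarrow>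
    sigma \<chi> q = positions Right_end \<chi> ! (length \<chi> - q)"
  by (simp add: sigma_def Let_def)

lemma side_sigma:
  assumes "q \<in> {1..length \<chi>}"
  shows "\<chi> ! (sigma \<chi> q - 1) = Left_end \<longleftrightarrow> q \<le> length (positions Left_end \<chi>)"
proof (cases "q \<le> length (positions Left_end \<chi>)")
  case True
  then have "sigma \<chi> q \<in> set (positions Left_end \<chi>)"
    using assms by (auto simp: sigma_left)
  with True show ?thesis by (auto simp: set_positions)
next
  case False
  then have "sigma \<chi> q \<in> set (positions Right_end \<chi>)"
    using assms length_positions_add[of \<chi>] by (auto simp: sigma_right intro!: nth_mem)
  with False show ?thesis by (auto simp: set_positions)
qed

text \<open>Preimages are explicit: the entry at index j of the left list comes from j + 1, that of
  the right list from n - j. Injectivity then follows by counting.\<close>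

lemma bij_betw_sigma: "bij_betw (sigma \<chi>) {1..length \<chi>} {1..length \<chi>}"
proof -
  let ?n = "length \<chi>"
  have sub: "{1..?n} \<subseteq> sigma \<chi> ` {1..?n}"
  proof
    fix x assume x: "x \<in> {1..?n}"
    show "x \<in> sigma \<chi> ` {1..?n}"
    proof (cases "\<chi> ! (x - 1)")
      case Left_end
      with x have "x \<in> set (positions Left_end \<chi>)" by (simp add: set_positions)
      then obtain j where "j < length (positions Left_end \<chi>)" "positions Left_end \<chi> ! j = x"
        by (auto simp: in_set_conv_nth)
      then have "sigma \<chi> (Suc j) = x" "Suc j \<in> {1..?n}"
        using length_positions_add[of \<chi>] by (auto simp: sigma_left)
      then show ?thesis by blast
    next
      case Right_end
      with x have "x \<in> set (positions Right_end \<chi>)" by (simp add: set_positions)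
      then obtain j where "j < length (positions Right_end \<chi>)" "positions Right_end \<chi> ! j = x"
        by (auto simp: in_set_conv_nth)
      then have "sigma \<chi> (?n - j) = x" "?n - j \<in> {1..?n}"
        using length_positions_add[of \<chi>] by (auto simp: sigma_right)
      then show ?thesis by blast
    qed
  qed
  have le: "card (sigma \<chi> ` {1..?n}) \<le> card {1..?n}" by (rule card_image_le) simp
  have eq: "{1..?n} = sigma \<chi> ` {1..?n}" by (rule card_seteq[OF _ sub le]) simp
  have "inj_on (sigma \<chi>) {1..?n}"
    by (rule eq_card_imp_inj_on, simp, subst eq[symmetric], rule refl)
  then show ?thesis by (rule bij_betw_imageI[OF _ eq[symmetric]])
qed

lemma bij_betw_rank: "bij_betw (rank \<chi>) {1..length \<chi>} {1..length \<chi>}"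
  unfolding rank_def by (rule bij_betw_inv_into[OF bij_betw_sigma])

lemma rank_in: "x \<in> {1..length \<chi>} \<Longrightarrow> rank \<chi> x \<in> {1..length \<chi>}"
  using bij_betwE[OF bij_betw_rank] by blast

lemma sigma_rank: "x \<in> {1..length \<chi>} \<Longrightarrow> sigma \<chi> (rank \<chi> x) = x"
  unfolding rank_def by (rule bij_betw_inv_into_right[OF bij_betw_sigma])

lemma rank_sigma: "q \<in> {1..length \<chi>} \<Longrightarrow> rank \<chi> (sigma \<chi> q) = q"
  unfolding rank_def by (rule bij_betw_inv_into_left[OF bij_betw_sigma])

text \<open>With u left moves, the ranks 1 to u run through the left times upwards and the larger
  ranks through the right times downwards. Hence an earlier time is extremal compared with a later
  one in the direction given by its own side, whatever the side of the later time.\<close>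

lemma rank_less_iff:
  assumes "1 \<le> x" "x < y" "y \<le> length \<chi>"
  shows "rank \<chi> x < rank \<chi> y \<longleftrightarrow> \<chi> ! (x - 1) = Left_end"
    and "rank \<chi> y < rank \<chi> x \<longleftrightarrow> \<chi> ! (x - 1) \<noteq> Left_end"
proof -
  let ?u = "length (positions Left_end \<chi>)" and ?p = "rank \<chi> x" and ?q = "rank \<chi> y"
  have x: "x \<in> {1..length \<chi>}" "y \<in> {1..length \<chi>}" using assms by auto
  note pq = rank_in[OF x(1)] rank_in[OF x(2)]
  have ne: "?p \<noteq> ?q" using sigma_rank[OF x(1)] sigma_rank[OF x(2)] assms by auto
  have side: "\<chi> ! (x - 1) = Left_end \<longleftrightarrow> ?p \<le> ?u"
    using side_sigma[OF pq(1)] sigma_rank[OF x(1)] by simp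
  have 1: "?p < ?q" if "?p \<le> ?u"
  proof (rule ccontr)
    assume "\<not> ?p < ?q"
    with ne have "?q < ?p" by simp
    with that pq have "sigma \<chi> ?q < sigma \<chi> ?p"
      using sorted_wrt_nth_less[OF sorted_positions[of Left_end \<chi>], of "?q - 1" "?p - 1"]
      by (auto simp: sigma_left)
    then show False using sigma_rank x assms by simp
  qed
  have 2: "?q < ?p" if "\<not> ?p \<le> ?u"
  proof (rule ccontr)
    assume "\<not> ?q < ?p"
    with ne have "?p < ?q" by simp
    moreover from this that pq length_positions_add[of \<chi>]
    have "length \<chi> - ?q < length \<chi> - ?p" "length \<chi> - ?p < length (positions Right_end \<chi>)"
      by auto
    ultimately have "sigma \<chi> ?q < sigma \<chi> ?p"
      using that pq sorted_wrt_nth_less[OF sorted_positions[of Right_end \<chi>], of "length \<chi> - ?q" "length \<chi> - ?p"]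
      by (auto simp: sigma_right)
    then show False using sigma_rank x assms by simp
  qed
  show "?p < ?q \<longleftrightarrow> \<chi> ! (x - 1) = Left_end" "?q < ?p \<longleftrightarrow> \<chi> ! (x - 1) \<noteq> Left_end"
    using 1 2 side by fastforce+
qed

text \<open>\<open>Min V\<close> stands for the move that inserts the balls of \<open>V\<close>. The
  times \<open>w\<close> after \<open>Min V\<close> in blocks with smaller minimum belong to the
  balls waiting in the deque at that moment, so the condition puts all of \<open>V\<close> on one
  side of them.\<close>

definition separated :: "side list \<Rightarrow> nat set set \<Rightarrow> bool" where
  "separated \<chi> \<rho> \<longleftrightarrow> (\<forall>V\<in>\<rho>. \<forall>W\<in>\<rho>. Min W < Min V \<longrightarrow>
     (\<forall>v\<in>V. \<forall>w\<in>W. Min V < w \<longrightarrow>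
       (if \<chi> ! (Min V - 1) = Left_end then rank \<chi> v < rank \<chi> w else rank \<chi> w < rank \<chi> v)))"

text \<open>This is a crossing, in the sense of \<open>NC\<close>, of the images of the two blocks
  under \<open>rank\<close>.\<close>

definition rank_crossing :: "side list \<Rightarrow> nat set \<Rightarrow> nat set \<Rightarrow> bool" where
  "rank_crossing \<chi> V W \<longleftrightarrow> (\<exists>a\<in>V. \<exists>b\<in>W. \<exists>c\<in>V. \<exists>d\<in>W.
     rank \<chi> a < rank \<chi> b \<and> rank \<chi> b < rank \<chi> c \<and> rank \<chi> c < rank \<chi> d)"

lemma partition_on_block:
  assumes "partition_on {1..n::nat} \<rho>" "V \<in> \<rho>"
  shows "finite V" "V \<noteq> {}" "V \<subseteq> {1..n}" "Min V \<in> V" "\<And>v. v \<in> V \<Longrightarrow> Min V \<le> v"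
proof -
  show V: "V \<noteq> {}" "V \<subseteq> {1..n}" using assms by (auto simp: partition_on_def)
  then show "finite V" by (meson finite_atLeastAtMost finite_subset)
  with V show "Min V \<in> V" "\<And>v. v \<in> V \<Longrightarrow> Min V \<le> v" by auto
qed

lemma partition_on_same_block:
  "partition_on A \<rho> \<Longrightarrow> V \<in> \<rho> \<Longrightarrow> W \<in> \<rho> \<Longrightarrow> x \<in> V \<Longrightarrow> x \<in> W \<Longrightarrow> V = W"
  using disjointD[OF partition_onD2, of A \<rho> V W] by blast

text \<open>If \<open>w\<close> precedes \<open>Min V\<close>, it is extremal in rank against all of
  \<open>V\<close> and cannot lie between two of its elements. If it follows \<open>Min V\<close>,
  separation puts it on one side of \<open>V\<close>.\<close>

lemma separated_not_between:
  assumes part: "partition_on {1..length \<chi>} \<rho>" and sep: "separated \<chi> \<rho>"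
    and V: "V \<in> \<rho>" and W: "W \<in> \<rho>" and less: "Min W < Min V"
    and "a \<in> V" "b \<in> V" "w \<in> W" "rank \<chi> a < rank \<chi> w" "rank \<chi> w < rank \<chi> b"
  shows False
proof -
  let ?i = "Min V"
  note pV = partition_on_block[OF part V] and pW = partition_on_block[OF part W]
  have ab: "?i \<le> a" "?i \<le> b" "1 \<le> ?i" "a \<le> length \<chi>" "b \<le> length \<chi>" "1 \<le> w" "w \<le> length \<chi>"
    using assms pV pW by auto
  have "w \<noteq> ?i"
    using partition_on_same_block[OF part V W pV(4)] less \<open>w \<in> W\<close> by auto
  moreover have "\<not> w < ?i"
    using rank_less_iff[of w a \<chi>] rank_less_iff[of w b \<chi>] ab assms by auto
  ultimately have "?i < w" by simp
  have "if \<chi> ! (?i - 1) = Left_end then rank \<chi> x < rank \<chi> w else rank \<chi> w < rank \<chi> x"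
    if "x \<in> V" for x
    using sep V W less that \<open>w \<in> W\<close> \<open>?i < w\<close> unfolding separated_def by blast
  from this[OF \<open>a \<in> V\<close>] this[OF \<open>b \<in> V\<close>] show False
    using assms(9,10) by (simp split: if_splits)
qed

text \<open>In a crossing each block has an element between two elements of the other, which is
  impossible for the block with the larger minimum. Conversely, a violation of separation at
  \<open>v\<close> and \<open>w\<close> becomes a crossing once the minima of the two blocks are
  added.\<close>

lemma separated_iff_not_crossing:
  assumes part: "partition_on {1..length \<chi>} \<rho>"
  shows "separated \<chi> \<rho> \<longleftrightarrow> \<not> (\<exists>V\<in>\<rho>. \<exists>W\<in>\<rho>. V \<noteq> W \<and> rank_crossing \<chi> V W)"
proof
  assume sep: "separated \<chi> \<rho>"
  show "\<not> (\<exists>V\<in>\<rho>. \<exists>W\<in>\<rho>. V \<noteq> W \<and> rank_crossing \<chi> V W)"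
  proof
    assume "\<exists>V\<in>\<rho>. \<exists>W\<in>\<rho>. V \<noteq> W \<and> rank_crossing \<chi> V W"
    then obtain V W a b c d where VW: "V \<in> \<rho>" "W \<in> \<rho>" "V \<noteq> W"
      and abcd: "a \<in> V" "b \<in> W" "c \<in> V" "d \<in> W" "rank \<chi> a < rank \<chi> b" "rank \<chi> b < rank \<chi> c"
        "rank \<chi> c < rank \<chi> d"
      unfolding rank_crossing_def by blast
    have "Min V \<noteq> Min W"
      using partition_on_same_block[OF part VW(1,2)] partition_on_block(4)[OF part] VW by metis
    then consider "Min W < Min V" | "Min V < Min W" by linarith
    then show False
      using separated_not_between[OF part sep VW(1,2)] separated_not_between[OF part sep VW(2,1)] abcd
      by cases blast+
  qed
next
  assume nc: "\<not> (\<exists>V\<in>\<rho>. \<exists>W\<in>\<rho>. V \<noteq> W \<and> rank_crossing \<chi> V W)"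
  show "separated \<chi> \<rho>"
    unfolding separated_def
  proof (intro ballI impI)
    fix V W v w
    assume V: "V \<in> \<rho>" and W: "W \<in> \<rho>" and less: "Min W < Min V" and v: "v \<in> V" and w: "w \<in> W"
      and iw: "Min V < w"
    let ?i = "Min V" and ?j = "Min W"
    note pV = partition_on_block[OF part V] and pW = partition_on_block[OF part W]
    have "V \<noteq> W" using less by auto
    then have ncr: "\<not> rank_crossing \<chi> V W" "\<not> rank_crossing \<chi> W V" using nc V W by auto
    have bounds: "?i \<le> v" "1 \<le> ?i" "v \<le> length \<chi>" "1 \<le> ?j" "w \<le> length \<chi>"
      using v w pV pW by auto
    have j: "?j \<in> W" and i: "?i \<in> V" using pV pW by auto
    have vw: "v \<noteq> w" using partition_on_same_block[OF part V W] v w \<open>V \<noteq> W\<close> by auto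
    then have "rank \<chi> v \<noteq> rank \<chi> w"
      using sigma_rank[of v \<chi>] sigma_rank[of w \<chi>] bounds iw by auto
    \<comment> \<open>Here \<open>?i\<close>, \<open>w\<close>, \<open>v\<close> have increasing
      ranks. The minimum \<open>?j\<close> precedes them all, so its rank is below or above all
      three, and either way the four times cross. The case of a right move is the mirror
      image.\<close>
    moreover have False if "\<chi> ! (?i - 1) = Left_end" "rank \<chi> w < rank \<chi> v"
    proof -
      have *: "rank \<chi> ?i < rank \<chi> w" using rank_less_iff(1)[of ?i w \<chi>] that bounds iw by auto
      show False
      proof (cases "\<chi> ! (?j - 1) = Left_end")
        case True
        then have "rank \<chi> ?j < rank \<chi> ?i" using rank_less_iff(1)[of ?j ?i \<chi>] bounds less iw by simp
        with * that i j v w have "rank_crossing \<chi> W V" unfolding rank_crossing_def by blast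
        with ncr show False by blast
      next
        case False
        then have "rank \<chi> v < rank \<chi> ?j" using rank_less_iff(2)[of ?j v \<chi>] bounds less iw by simp
        with * that i j v w have "rank_crossing \<chi> V W" unfolding rank_crossing_def by blast
        with ncr show False by blast
      qed
    qed
    moreover have False if "\<chi> ! (?i - 1) \<noteq> Left_end" "rank \<chi> v < rank \<chi> w"
    proof -
      have *: "rank \<chi> w < rank \<chi> ?i" using rank_less_iff(2)[of ?i w \<chi>] that bounds iw by auto
      show False
      proof (cases "\<chi> ! (?j - 1) = Left_end")
        case True
        then have "rank \<chi> ?j < rank \<chi> v" using rank_less_iff(1)[of ?j v \<chi>] bounds less iw by simp
        with * that i j v w have "rank_crossing \<chi> W V" unfolding rank_crossing_def by blast
        with ncr show False by blast
      next
        case False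
        then have "rank \<chi> ?i < rank \<chi> ?j" using rank_less_iff(2)[of ?j ?i \<chi>] bounds less iw by simp
        with * that i j v w have "rank_crossing \<chi> V W" unfolding rank_crossing_def by blast
        with ncr show False by blast
      qed
    qed
    ultimately show "if \<chi> ! (?i - 1) = Left_end then rank \<chi> v < rank \<chi> w else rank \<chi> w < rank \<chi> v"
      by (meson linorder_neqE_nat)
  qed
qed

section \<open>Transport of partitions along a permutation\<close>

lemma partition_on_act:
  assumes "bij_betw f A A" "partition_on A \<pi>"
  shows "partition_on A (act f \<pi>)"
proof -
  have "partition_on (f ` A) (act f \<pi> - {{}})"
    unfolding act_def using assms by (intro partition_on_inj_image) (auto simp: bij_betw_def)
  moreover have "{} \<notin> act f \<pi>"
    using partition_onD3[OF assms(2)] by (auto simp: act_def)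
  ultimately show ?thesis using assms(1) by (simp add: bij_betw_def)
qed

lemma act_act_inverse:
  assumes "partition_on A \<pi>" "\<And>x. x \<in> A \<Longrightarrow> f (g x) = x"
  shows "act f (act g \<pi>) = \<pi>"
proof -
  have "f ` (g ` V) = V" if "V \<in> \<pi>" for V
  proof -
    have "V \<subseteq> A" using assms(1) that by (auto simp: partition_on_def)
    then show ?thesis using assms(2) by force
  qed
  then show ?thesis unfolding act_def by (simp add: image_image)
qed

text \<open>Since \<open>rank\<close> inverts \<open>sigma\<close>, a crossing of a partition is the
  same as a rank crossing of its image. The preimage of a separated partition is obtained by acting
  with \<open>rank\<close>.\<close>

lemma act_sigma_NC:
  "{act (sigma \<chi>) \<pi> | \<pi>. \<pi> \<in> NC (length \<chi>)} =
    {\<rho>. partition_on {1..length \<chi>} \<rho> \<and> separated \<chi> \<rho>}" (is "?L = ?R")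
proof -
  let ?n = "length \<chi>"
  show ?thesis
  proof (intro equalityI subsetI)
    fix \<rho> assume "\<rho> \<in> ?L"
    then obtain \<pi> where \<rho>: "\<rho> = act (sigma \<chi>) \<pi>" and nc: "\<pi> \<in> NC ?n" by blast
    then have part: "partition_on {1..?n} \<pi>" by (simp add: NC_def)
    have part': "partition_on {1..?n} \<rho>"
      unfolding \<rho> by (rule partition_on_act[OF bij_betw_sigma part])
    have rs: "rank \<chi> (sigma \<chi> x) = x" if "x \<in> V" "V \<in> \<pi>" for x V
      using partition_on_block(3)[OF part that(2)] that(1) by (intro rank_sigma) auto
    have "\<not> (\<exists>V\<in>\<rho>. \<exists>W\<in>\<rho>. V \<noteq> W \<and> rank_crossing \<chi> V W)"
    proof
      assume "\<exists>V\<in>\<rho>. \<exists>W\<in>\<rho>. V \<noteq> W \<and> rank_crossing \<chi> V W"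
      then obtain V W where VW: "V \<in> \<pi>" "W \<in> \<pi>" "V \<noteq> W"
        and "rank_crossing \<chi> (sigma \<chi> ` V) (sigma \<chi> ` W)"
        unfolding \<rho> act_def by blast
      then obtain a b c d where "a \<in> V" "b \<in> W" "c \<in> V" "d \<in> W" "a < b" "b < c" "c < d"
        unfolding rank_crossing_def using rs by auto
      then have "\<exists>a b c d. a < b \<and> b < c \<and> c < d \<and> a \<in> V \<and> c \<in> V \<and> b \<in> W \<and> d \<in> W"
        by blast
      moreover have "\<not> (\<exists>a b c d. a < b \<and> b < c \<and> c < d \<and> a \<in> V \<and> c \<in> V \<and> b \<in> W \<and> d \<in> W)"
        using nc VW unfolding NC_def mem_Collect_eq by meson
      ultimately show False by (rule notE[rotated])
    qed
    then show "\<rho> \<in> ?R" using part' separated_iff_not_crossing by blast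
  next
    fix \<rho> assume "\<rho> \<in> ?R"
    then have part: "partition_on {1..?n} \<rho>" and sep: "separated \<chi> \<rho>" by auto
    define \<pi> where "\<pi> = act (rank \<chi>) \<rho>"
    have "partition_on {1..?n} \<pi>"
      unfolding \<pi>_def by (rule partition_on_act[OF bij_betw_rank part])
    moreover have "\<not> (\<exists>V\<in>\<pi>. \<exists>W\<in>\<pi>. V \<noteq> W \<and>
          (\<exists>a b c d. a < b \<and> b < c \<and> c < d \<and> a \<in> V \<and> c \<in> V \<and> b \<in> W \<and> d \<in> W))"
    proof
      assume "\<exists>V\<in>\<pi>. \<exists>W\<in>\<pi>. V \<noteq> W \<and>
          (\<exists>a b c d. a < b \<and> b < c \<and> c < d \<and> a \<in> V \<and> c \<in> V \<and> b \<in> W \<and> d \<in> W)"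
      then obtain V W where "V \<in> \<rho>" "W \<in> \<rho>" "V \<noteq> W" "rank_crossing \<chi> V W"
        unfolding \<pi>_def act_def rank_crossing_def by blast
      with sep separated_iff_not_crossing[OF part] show False by blast
    qed
    ultimately have "\<pi> \<in> NC ?n" by (simp add: NC_def)
    moreover have "act (sigma \<chi>) \<pi> = \<rho>"
      unfolding \<pi>_def using part sigma_rank by (rule act_act_inverse)
    ultimately show "\<rho> \<in> ?L" by blast
  qed
qed

subsection \<open>Insertion vectors of Lukasiewicz paths\<close>

text \<open>These are the vectors (p_1,...,p_n) of Lukasiewicz paths: the height after i steps is
  p_1 + ... + p_i - i, which has to be nonnegative for every i and 0 at the end.\<close>

definition admissible :: "nat \<Rightarrow> nat list \<Rightarrow> bool" where
  "admissible n p \<longleftrightarrow> length p = n \<and> sum_list p = n \<and> (\<forall>i\<le>n. i \<le> sum_list (take i p))"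

lemma length_insertions: "length (insertions lam) = length lam - 1"
  by (simp add: insertions_def rise_vector_def)

text \<open>The rises telescope. The conversion by \<open>nat\<close> in \<open>insertions\<close>
  loses nothing because every step is at least -1.\<close>

lemma sum_insertions:
  assumes "lam \<in> Luk n" "i \<le> n"
  shows "int (sum_list (take i (insertions lam))) = snd (lam ! i) + int i"
  using assms(2)
proof (induction i)
  case 0
  then show ?case using assms(1) by (simp add: Luk_def)
next
  case (Suc i)
  have len: "length lam = n + 1" using assms(1) by (simp add: Luk_def)
  obtain k where k: "k \<ge> -1" "lam ! (i + 1) = (fst (lam ! i) + 1, snd (lam ! i) + k)"
    using assms(1) Suc.prems by (auto simp: Luk_def Suc_le_eq)
  have "insertions lam ! i = nat (k + 1)"
    using Suc.prems len k by (simp add: insertions_def rise_vector_def)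
  then show ?case
    using Suc k len by (simp add: take_Suc_conv_app_nth length_insertions)
qed

lemma admissible_insertions:
  assumes "lam \<in> Luk n"
  shows "admissible n (insertions lam)"
proof -
  have len: "length (insertions lam) = n"
    using assms by (simp add: Luk_def length_insertions)
  have "i \<le> sum_list (take i (insertions lam))" if "i \<le> n" for i
  proof -
    have "snd (lam ! i) \<ge> 0" using assms that by (simp add: Luk_def)
    with sum_insertions[OF assms that] show ?thesis by simp
  qed
  moreover have "sum_list (insertions lam) = n"
    using sum_insertions[OF assms order_refl] len assms by (simp add: Luk_def)
  ultimately show ?thesis using len by (simp add: admissible_def)
qed

lemma Luk_of_admissible:
  assumes "admissible n p"
  obtains lam where "lam \<in> Luk n" "insertions lam = p"
proof
  \<comment> \<open>The height after m steps is the number of balls inserted minus the number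
    removed.\<close>
  define lam where
    "lam = map (\<lambda>m. (int m, int (sum_list (take m p)) - int m)) [0..<n + 1]"
  have nth: "lam ! m = (int m, int (sum_list (take m p)) - int m)" if "m \<le> n" for m
    using that unfolding lam_def by (subst nth_map) (auto simp del: upt_Suc)
  have len: "length lam = n + 1" by (simp add: lam_def)
  have step: "sum_list (take (Suc m) p) = sum_list (take m p) + p ! m" if "m < n" for m
    using that assms by (simp add: take_Suc_conv_app_nth admissible_def)
  show "lam \<in> Luk n"
    unfolding Luk_def
  proof (intro CollectI conjI allI impI)
    fix m assume m: "m < n"
    show "\<exists>i\<ge>-1. lam ! (m + 1) = (fst (lam ! m) + 1, snd (lam ! m) + i)"
      using m by (intro exI[of _ "int (p ! m) - 1"]) (simp add: nth step)
  next
    fix m assume "m \<le> n"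
    then show "0 \<le> snd (lam ! m)" using assms by (simp add: nth admissible_def)
  qed (use assms in \<open>auto simp: len nth admissible_def\<close>)
  show "insertions lam = p"
  proof (rule nth_equalityI)
    show "length (insertions lam) = length p"
      using assms by (simp add: length_insertions len admissible_def)
    fix i assume "i < length (insertions lam)"
    then have "i < n" by (simp add: length_insertions len)
    then show "insertions lam ! i = p ! i"
      by (simp add: insertions_def rise_vector_def len nth step)
  qed
qed

subsection \<open>Output times along a deque run\<close>

declare deque.simps(2) [simp del]

section \<open>Effect of a single move, and the label intervals\<close>

lemma fold_insert_ball:
  "fold (insert_ball s) xs d = (if s = Left_end then rev xs @ d else d @ xs)"
  by (induction xs arbitrary: d; cases s) auto

lemma insert_phase_eq:
  "insert_phase \<chi> p i d =
    (if \<chi> ! (i - 1) = Left_end then rev (labels p i) @ d else d @ labels p i)"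
  by (simp add: insert_phase_def fold_insert_ball)

lemma end_ball_remove_end:
  assumes "d \<noteq> []"
  shows "d = (if s = Left_end then end_ball s d # remove_end s d else remove_end s d @ [end_ball s d])"
  using assms by (cases s) auto

lemma sum_list_take_Suc:
  "i < length p \<Longrightarrow> sum_list (take (Suc i) p) = sum_list (take i p) + (p ! i :: nat)"
  by (simp add: take_Suc_conv_app_nth)

lemma sum_list_take_mono:
  "i \<le> j \<Longrightarrow> sum_list (take i p) \<le> sum_list (take j (p :: nat list))"
  by (metis le_add1 le_Suc_ex sum_list_append take_add)

lemma in_labels_iff:
  "b \<in> set (labels p i) \<longleftrightarrow> sum_list (take (i - 1) p) < b \<and> b \<le> sum_list (take i p)"
  by (auto simp: labels_def)

lemma distinct_labels: "distinct (labels p i)"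
  by (simp add: labels_def)

text \<open>The label sets are consecutive intervals cut out by the partial sums of
  \<open>p\<close>.\<close>

lemma labels_unique:
  assumes "b \<in> set (labels p i)" "b \<in> set (labels p j)"
  shows "i = j"
proof (rule ccontr)
  assume "i \<noteq> j"
  then have "i \<le> j - 1 \<or> j \<le> i - 1" by linarith
  then show False
    using assms sum_list_take_mono[of i "j - 1" p] sum_list_take_mono[of j "i - 1" p]
    unfolding in_labels_iff by linarith
qed

lemma ball_in_labels:
  assumes "1 \<le> b" "b \<le> sum_list p"
  obtains i where "1 \<le> i" "i \<le> length p" "b \<in> set (labels p i)" "p ! (i - 1) > 0"
proof -
  \<comment> \<open>Ball \<open>b\<close> enters in the first move after which at least
    \<open>b\<close> balls have been inserted.\<close>
  define i where "i = (LEAST i. b \<le> sum_list (take i p))"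
  have ex: "b \<le> sum_list (take (length p) p)" using assms by simp
  have le: "b \<le> sum_list (take i p)" unfolding i_def by (rule LeastI[of _ "length p"]) (rule ex)
  have len: "i \<le> length p" unfolding i_def by (rule Least_le) (rule ex)
  have pos: "1 \<le> i" using le assms by (cases i) auto
  have nle: "\<not> b \<le> sum_list (take (i - 1) p)"
    unfolding i_def by (rule not_less_Least) (use pos i_def in simp)
  then have "b \<in> set (labels p i)" using le by (simp add: in_labels_iff)
  moreover have "p ! (i - 1) > 0"
    using le nle pos len sum_list_take_Suc[of "i - 1" p] by simp
  ultimately show ?thesis using that pos len by blast
qed

section \<open>Contents of the deque and removal of every ball\<close>

lemma set_insert_phase: "set (insert_phase \<chi> p i d) = set (labels p i) \<union> set d"
  by (auto simp: insert_phase_eq)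

lemma removed_ball_Suc:
  "removed_ball \<chi> p (Suc i) = end_ball (\<chi> ! i) (insert_phase \<chi> p (Suc i) (deque \<chi> p i))"
  by (simp add: removed_ball_def)

text \<open>The four claims support each other: removed balls stay within the labels used so far, so
  new labels are fresh and the deque stays distinct; distinctness makes each removal delete exactly
  one ball, and the length count shows that there is a ball to remove.\<close>

lemma deque_invariant:
  assumes adm: "admissible (length \<chi>) p" and "i \<le> length \<chi>"
  shows "distinct (deque \<chi> p i) \<and>
    set (deque \<chi> p i) = {1..sum_list (take i p)} - removed_ball \<chi> p ` {1..i} \<and>
    removed_ball \<chi> p ` {1..i} \<subseteq> {1..sum_list (take i p)} \<and>
    length (deque \<chi> p i) + i = sum_list (take i p)"
  using assms(2)
proof (induction i)
  case 0
  then show ?case by simp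
next
  case (Suc i)
  let ?s = "\<lambda>i. sum_list (take i p)" and ?R = "removed_ball \<chi> p"
  define D where "D = insert_phase \<chi> p (Suc i) (deque \<chi> p i)"
  from Suc have dist: "distinct (deque \<chi> p i)"
    and set: "set (deque \<chi> p i) = {1..?s i} - ?R ` {1..i}"
    and sub: "?R ` {1..i} \<subseteq> {1..?s i}"
    and len: "length (deque \<chi> p i) + i = ?s i" by auto
  have mono: "?s i \<le> ?s (Suc i)" by (rule sum_list_take_mono) simp
  have lab: "set (labels p (Suc i)) = {?s i<..?s (Suc i)}" by (auto simp: in_labels_iff)
  have "distinct D"
    using dist set by (auto simp: D_def insert_phase_eq distinct_labels lab)
  have setD: "set D = {1..?s (Suc i)} - ?R ` {1..i}"
    using sub mono unfolding D_def set_insert_phase lab set by fastforce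
  have "length (labels p (Suc i)) = ?s (Suc i) - ?s i"
    unfolding labels_def length_upt by simp
  moreover have "length D = length (labels p (Suc i)) + length (deque \<chi> p i)"
    by (simp add: D_def insert_phase_eq)
  ultimately have lenD: "length D + i = ?s (Suc i)" using len mono by linarith
  \<comment> \<open>The prefix condition of \<open>admissible\<close> keeps the deque nonempty at
    each removal, so \<open>hd\<close> and \<open>last\<close> return actual balls.\<close>
  have "Suc i \<le> ?s (Suc i)" using adm Suc.prems by (simp add: admissible_def)
  with lenD have "D \<noteq> []" by auto
  note split = end_ball_remove_end[OF this, of "\<chi> ! i"]
  have R: "end_ball (\<chi> ! i) D = ?R (Suc i)" "remove_end (\<chi> ! i) D = deque \<chi> p (Suc i)"
    by (simp_all add: D_def removed_ball_Suc deque.simps)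
  have "distinct (deque \<chi> p (Suc i)) \<and> ?R (Suc i) \<notin> set (deque \<chi> p (Suc i)) \<and>
      set D = insert (?R (Suc i)) (set (deque \<chi> p (Suc i))) \<and>
      length D = Suc (length (deque \<chi> p (Suc i)))"
    using split \<open>distinct D\<close> unfolding R by (cases "\<chi> ! i = Left_end") auto
  then show ?case
    using setD lenD sub mono by (auto simp: atLeastAtMostSuc_conv)
qed

lemma set_deque:
  assumes "admissible (length \<chi>) p" "i \<le> length \<chi>"
  shows "set (deque \<chi> p i) = {1..sum_list (take i p)} - removed_ball \<chi> p ` {1..i}"
  using deque_invariant[OF assms] by blast

lemma sum_list_take_le:
  "admissible n p \<Longrightarrow> sum_list (take i p) \<le> n"
  using sum_list_take_mono[of i "max i n" p] by (simp add: admissible_def)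

text \<open>After n moves n balls were inserted and n removed, so the deque is empty and every ball
  has left. Surjectivity on a finite set gives injectivity.\<close>

lemma bij_betw_removed_ball:
  assumes adm: "admissible (length \<chi>) p"
  shows "bij_betw (removed_ball \<chi> p) {1..length \<chi>} {1..length \<chi>}"
proof -
  let ?n = "length \<chi>" and ?R = "removed_ball \<chi> p"
  have sum: "sum_list (take ?n p) = ?n" using adm by (simp add: admissible_def)
  then have "deque \<chi> p ?n = []" using deque_invariant[OF adm order_refl] by simp
  then have eq: "?R ` {1..?n} = {1..?n}"
    using deque_invariant[OF adm order_refl] sum by auto
  then have "inj_on ?R {1..?n}" by (intro eq_card_imp_inj_on) simp_all
  then show ?thesis using eq by (rule bij_betw_imageI)
qed

section \<open>Rank order of the output times in the deque\<close>

definition rank_sorted :: "side list \<Rightarrow> nat list \<Rightarrow> bool" where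
  "rank_sorted \<chi> ts \<longleftrightarrow> sorted_wrt (\<lambda>x y. rank \<chi> x < rank \<chi> y) ts"

lemma rank_sorted_append:
  "rank_sorted \<chi> (xs @ ys) \<longleftrightarrow>
    rank_sorted \<chi> xs \<and> rank_sorted \<chi> ys \<and> (\<forall>x\<in>set xs. \<forall>y\<in>set ys. rank \<chi> x < rank \<chi> y)"
  by (simp add: rank_sorted_def sorted_wrt_append)

lemma rank_sorted_Cons:
  "rank_sorted \<chi> (x # ys) \<longleftrightarrow> rank_sorted \<chi> ys \<and> (\<forall>y\<in>set ys. rank \<chi> x < rank \<chi> y)"
  by (auto simp: rank_sorted_def)

lemma rank_sorted_Nil: "rank_sorted \<chi> []"
  by (simp add: rank_sorted_def)

text \<open>Every ball leaves exactly once in an admissible run, so inverting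
  \<open>removed_ball\<close> turns the relation \<open>has_output_time\<close> into a function on
  the balls 1 to n.\<close>

definition output_time :: "side list \<Rightarrow> nat list \<Rightarrow> nat \<Rightarrow> nat" where
  "output_time \<chi> p = inv_into {1..length \<chi>} (removed_ball \<chi> p)"

lemma
  assumes adm: "admissible (length \<chi>) p"
  shows output_time_in: "b \<in> {1..length \<chi>} \<Longrightarrow> output_time \<chi> p b \<in> {1..length \<chi>}"
    and removed_ball_output_time:
      "b \<in> {1..length \<chi>} \<Longrightarrow> removed_ball \<chi> p (output_time \<chi> p b) = b"
    and output_time_removed_ball:
      "t \<in> {1..length \<chi>} \<Longrightarrow> output_time \<chi> p (removed_ball \<chi> p t) = t"
    and removed_ball_in: "t \<in> {1..length \<chi>} \<Longrightarrow> removed_ball \<chi> p t \<in> {1..length \<chi>}"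
  unfolding output_time_def
  using bij_betwE[OF bij_betw_inv_into[OF bij_betw_removed_ball[OF adm]]]
    bij_betw_inv_into_right[OF bij_betw_removed_ball[OF adm]]
    bij_betw_inv_into_left[OF bij_betw_removed_ball[OF adm]]
    bij_betwE[OF bij_betw_removed_ball[OF adm]]
  by blast+

lemma labels_subset:
  "admissible n p \<Longrightarrow> set (labels p i) \<subseteq> {1..n}"
  using sum_list_take_le[of n p i] by (auto simp: in_labels_iff)

lemma output_block_eq:
  assumes adm: "admissible (length \<chi>) p"
  shows "output_block \<chi> p i = output_time \<chi> p ` set (labels p i)"
proof (intro equalityI subsetI)
  fix t assume "t \<in> output_block \<chi> p i"
  then show "t \<in> output_time \<chi> p ` set (labels p i)"
    unfolding output_block_def has_output_time_def
    using output_time_removed_ball[OF adm] by force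
next
  fix t assume "t \<in> output_time \<chi> p ` set (labels p i)"
  then show "t \<in> output_block \<chi> p i"
    unfolding output_block_def has_output_time_def
    using labels_subset[OF adm, of i] output_time_in[OF adm] removed_ball_output_time[OF adm] by blast
qed

lemma output_time_deque:
  assumes adm: "admissible (length \<chi>) p" and i: "i \<le> length \<chi>" and b: "b \<in> set (deque \<chi> p i)"
  shows "i < output_time \<chi> p b" "output_time \<chi> p b \<le> length \<chi>"
proof -
  have b': "b \<in> {1..length \<chi>}" "b \<notin> removed_ball \<chi> p ` {1..i}"
    using b set_deque[OF adm i] sum_list_take_le[OF adm, of i] by auto
  show "output_time \<chi> p b \<le> length \<chi>" using output_time_in[OF adm b'(1)] by simp
  show "i < output_time \<chi> p b"
  proof (rule ccontr)
    assume "\<not> ?thesis"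
    then have "output_time \<chi> p b \<in> {1..i}" using output_time_in[OF adm b'(1)] by simp
    with b' removed_ball_output_time[OF adm b'(1)] show False by (metis imageI)
  qed
qed

lemma insert_phase_not_Nil:
  assumes adm: "admissible (length \<chi>) p" and i: "i < length \<chi>"
  shows "insert_phase \<chi> p (Suc i) (deque \<chi> p i) \<noteq> []"
proof
  assume "insert_phase \<chi> p (Suc i) (deque \<chi> p i) = []"
  then have empty: "labels p (Suc i) = []" "deque \<chi> p i = []"
    by (auto simp: insert_phase_eq split: if_splits)
  have "sum_list (take i p) = i" using deque_invariant[OF adm, of i] i empty by simp
  \<comment> \<open>The last label the move could insert is not in the empty list, so the partial
    sum has not grown beyond i.\<close>
  then have "sum_list (take (Suc i) p) \<le> i"
    using in_labels_iff[of "sum_list (take (Suc i) p)" p "Suc i"] empty by simp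
  moreover have "Suc i \<le> sum_list (take (Suc i) p)" using adm i by (simp add: admissible_def)
  ultimately show False by simp
qed

lemma output_times_insert_phase:
  assumes adm: "admissible (length \<chi>) p" and i: "i < length \<chi>"
  shows "map (output_time \<chi> p) (insert_phase \<chi> p (Suc i) (deque \<chi> p i)) =
    (if \<chi> ! i = Left_end then Suc i # map (output_time \<chi> p) (deque \<chi> p (Suc i))
     else map (output_time \<chi> p) (deque \<chi> p (Suc i)) @ [Suc i])"
proof -
  have "output_time \<chi> p (removed_ball \<chi> p (Suc i)) = Suc i"
    using i by (intro output_time_removed_ball[OF adm]) simp
  then show ?thesis
    using arg_cong[OF end_ball_remove_end[OF insert_phase_not_Nil[OF assms], of "\<chi> ! i"],
        of "map (output_time \<chi> p)"]
    unfolding removed_ball_Suc[symmetric] deque.simps(2)[symmetric] by (simp split: if_splits)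
qed

text \<open>Order is carried backwards over a removal. The departing ball has output time
  \<open>Suc i\<close>, which precedes all other output times present, and its rank is extremal on
  exactly the side where the ball stands.\<close>

lemma rank_sorted_insert_phase:
  assumes adm: "admissible (length \<chi>) p" and i: "i < length \<chi>"
    and sorted: "rank_sorted \<chi> (map (output_time \<chi> p) (deque \<chi> p (Suc i)))"
  shows "rank_sorted \<chi> (map (output_time \<chi> p) (insert_phase \<chi> p (Suc i) (deque \<chi> p i)))"
proof -
  have "if \<chi> ! i = Left_end then rank \<chi> (Suc i) < rank \<chi> (output_time \<chi> p b)
      else rank \<chi> (output_time \<chi> p b) < rank \<chi> (Suc i)" if "b \<in> set (deque \<chi> p (Suc i))" for b
    using output_time_deque[OF adm _ that] rank_less_iff[of "Suc i" "output_time \<chi> p b" \<chi>] i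
    by auto
  then show ?thesis
    unfolding output_times_insert_phase[OF adm i]
    using sorted by (simp add: rank_sorted_Cons rank_sorted_append rank_sorted_Nil split: if_splits)
qed

text \<open>Since balls leave only at the ends, the output times of the balls present at any moment
  form the increasing sequence of left removals followed by the decreasing one of right removals.\<close>

lemma rank_sorted_deque:
  assumes adm: "admissible (length \<chi>) p" and "i \<le> length \<chi>"
  shows "rank_sorted \<chi> (map (output_time \<chi> p) (deque \<chi> p i))"
  using assms(2)
\<comment> \<open>The induction runs downwards from the empty deque after the last move.\<close>
proof (induction i rule: inc_induct)
  case base
  have "deque \<chi> p (length \<chi>) = []"
    using deque_invariant[OF adm order_refl] adm by (simp add: admissible_def)
  then show ?case by (simp add: rank_sorted_Nil)
next
  case (step i)
  \<comment> \<open>The deque before the insertion is a suffix or prefix of the one after it, hence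
    inherits the order.\<close>
  from rank_sorted_insert_phase[OF adm step(2,3)] show ?case
    by (simp add: insert_phase_eq rank_sorted_append split: if_splits)
qed

text \<open>The last ball inserted in move i stands at the end from which move i removes, so it
  leaves at once. No ball of this move can leave earlier, since the earlier removals only concern
  labels inserted before.\<close>

lemma Min_output_block:
  assumes adm: "admissible (length \<chi>) p" and i: "1 \<le> i" "i \<le> length \<chi>" "p ! (i - 1) > 0"
  shows "i \<in> output_block \<chi> p i" "Min (output_block \<chi> p i) = i"
proof -
  obtain k where k: "i = Suc k" using i by (cases i) auto
  have ne: "labels p i \<noteq> []"
    using i k adm by (simp add: labels_def sum_list_take_Suc admissible_def)
  then have "end_ball (\<chi> ! k) (insert_phase \<chi> p i (deque \<chi> p k)) \<in> set (labels p i)"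
    by (cases "\<chi> ! k") (simp_all add: insert_phase_eq k hd_append hd_rev)
  then have "removed_ball \<chi> p i \<in> set (labels p i)" unfolding k removed_ball_Suc .
  then show mem: "i \<in> output_block \<chi> p i"
    using i by (auto simp: output_block_def has_output_time_def)
  have "i \<le> t" if "t \<in> output_block \<chi> p i" for t
  proof -
    have t: "t \<in> {1..length \<chi>}" "removed_ball \<chi> p t \<in> set (labels p i)"
      using that by (auto simp: output_block_def has_output_time_def)
    have "removed_ball \<chi> p t \<notin> removed_ball \<chi> p ` {1..k}"
      using deque_invariant[OF adm, of k] t(2) i k by (auto simp: in_labels_iff)
    with t show ?thesis using k by (metis atLeastAtMost_iff imageI not_less_eq_eq)
  qed
  moreover have "finite (output_block \<chi> p i)" unfolding output_block_eq[OF adm] by simp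
  ultimately show "Min (output_block \<chi> p i) = i" using mem by (intro Min_eqI) auto
qed

text \<open>This is the value of \<open>Phi\<close> on a path with insertion vector
  \<open>p\<close>, so that paths can be left aside.\<close>

definition blocks :: "side list \<Rightarrow> nat list \<Rightarrow> nat set set" where
  "blocks \<chi> p = {output_block \<chi> p i | i. 1 \<le> i \<and> i \<le> length \<chi> \<and> p ! (i - 1) > 0}"

lemma output_block_unique:
  assumes "t \<in> output_block \<chi> p i" "t \<in> output_block \<chi> p j"
  shows "i = j"
  using assms labels_unique unfolding output_block_def has_output_time_def by blast

text \<open>Each time outputs one ball, which was inserted in exactly one move; a move that inserts
  balls outputs one of them itself, so no block is empty.\<close>

lemma partition_on_blocks:
  assumes adm: "admissible (length \<chi>) p"
  shows "partition_on {1..length \<chi>} (blocks \<chi> p)"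
proof (rule partition_onI)
  show "\<Union> (blocks \<chi> p) = {1..length \<chi>}"
  proof (intro equalityI subsetI)
    fix t assume "t \<in> \<Union> (blocks \<chi> p)"
    then show "t \<in> {1..length \<chi>}"
      by (auto simp: blocks_def output_block_def has_output_time_def)
  next
    fix t assume t: "t \<in> {1..length \<chi>}"
    then have "1 \<le> removed_ball \<chi> p t" "removed_ball \<chi> p t \<le> sum_list p" "length p = length \<chi>"
      using removed_ball_in[OF adm t] adm by (auto simp: admissible_def)
    then obtain i where "1 \<le> i" "i \<le> length \<chi>" "removed_ball \<chi> p t \<in> set (labels p i)"
      "p ! (i - 1) > 0"
      using ball_in_labels by metis
    with t show "t \<in> \<Union> (blocks \<chi> p)"
      unfolding blocks_def output_block_def has_output_time_def by blast
  qed
next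
  fix V W assume "V \<in> blocks \<chi> p" "W \<in> blocks \<chi> p" "V \<noteq> W"
  then show "disjnt V W"
    unfolding blocks_def disjnt_def using output_block_unique by blast
next
  show "{} \<notin> blocks \<chi> p"
    using Min_output_block(1)[OF adm] unfolding blocks_def by blast
qed

text \<open>The ball leaving at time \<open>w\<close> was inserted before move \<open>Min V\<close>
  and leaves after it, so it is in the deque when the balls of \<open>V\<close> enter on one side of
  it. The deque after this insertion is in rank order.\<close>

lemma separated_blocks:
  assumes adm: "admissible (length \<chi>) p"
  shows "separated \<chi> (blocks \<chi> p)"
  unfolding separated_def
proof (intro ballI impI)
  fix V W v w
  assume V: "V \<in> blocks \<chi> p" and W: "W \<in> blocks \<chi> p" and less: "Min W < Min V"
    and v: "v \<in> V" and w: "w \<in> W" and iw: "Min V < w"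
  obtain i where i: "V = output_block \<chi> p i" "1 \<le> i" "i \<le> length \<chi>" "Min V = i"
    using V Min_output_block(2)[OF adm] unfolding blocks_def by blast
  obtain j where j: "W = output_block \<chi> p j" "1 \<le> j" "j \<le> length \<chi>" "Min W = j"
    using W Min_output_block(2)[OF adm] unfolding blocks_def by blast
  obtain k where k: "i = Suc k" using i by (cases i) auto
  obtain b where b: "v = output_time \<chi> p b" "b \<in> set (labels p i)"
    using v unfolding i(1) output_block_eq[OF adm] by blast
  obtain c where c: "w = output_time \<chi> p c" "c \<in> set (labels p j)"
    using w unfolding j(1) output_block_eq[OF adm] by blast
  have "c \<le> sum_list (take k p)" "1 \<le> c"
    using c(2) sum_list_take_mono[of j k p] less i j k by (auto simp: in_labels_iff)
  moreover have "c \<notin> removed_ball \<chi> p ` {1..k}"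
  proof
    assume "c \<in> removed_ball \<chi> p ` {1..k}"
    then obtain t where t: "c = removed_ball \<chi> p t" "1 \<le> t" "t \<le> k" by auto
    then have "w = t" using output_time_removed_ball[OF adm, of t] c(1) i k by simp
    then show False using t iw i k by simp
  qed
  ultimately have "c \<in> set (deque \<chi> p k)" using set_deque[OF adm, of k] i k by simp
  moreover have "rank_sorted \<chi> (map (output_time \<chi> p) (insert_phase \<chi> p i (deque \<chi> p k)))"
    unfolding k using rank_sorted_insert_phase[OF adm _ rank_sorted_deque[OF adm]] i k by simp
  ultimately show "if \<chi> ! (Min V - 1) = Left_end then rank \<chi> v < rank \<chi> w else rank \<chi> w < rank \<chi> v"
    using b c unfolding i(4)
    by (simp add: insert_phase_eq rank_sorted_append split: if_splits)
qed

subsection \<open>Realizing a separated partition\<close>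

text \<open>As \<open>sigma\<close> enumerates the times by increasing rank, filtering its values
  lists \<open>A\<close> in rank order.\<close>

definition rank_list :: "side list \<Rightarrow> nat set \<Rightarrow> nat list" where
  "rank_list \<chi> A = filter (\<lambda>t. t \<in> A) (map (sigma \<chi>) [1..<Suc (length \<chi>)])"

lemma set_rank_list: "A \<subseteq> {1..length \<chi>} \<Longrightarrow> set (rank_list \<chi> A) = A"
  using bij_betw_imp_surj_on[OF bij_betw_sigma, of \<chi>]
  by (auto simp: rank_list_def atLeastLessThanSuc_atLeastAtMost simp del: upt_Suc)

lemma rank_sorted_rank_list: "rank_sorted \<chi> (rank_list \<chi> A)"
proof -
  have "sorted_wrt (\<lambda>p q. rank \<chi> (sigma \<chi> p) < rank \<chi> (sigma \<chi> q)) [1..<Suc (length \<chi>)]"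
    by (rule sorted_wrt_mono_rel[OF _ sorted_wrt_upt]) (simp add: rank_sigma del: upt_Suc)
  then show ?thesis
    unfolding rank_sorted_def rank_list_def by (intro sorted_wrt_filter) (simp add: sorted_wrt_map del: upt_Suc)
qed

lemma rank_sorted_distinct: "rank_sorted \<chi> ts \<Longrightarrow> distinct ts"
  unfolding rank_sorted_def by (induction ts) auto

lemma length_rank_list:
  "A \<subseteq> {1..length \<chi>} \<Longrightarrow> length (rank_list \<chi> A) = card A"
  using distinct_card[OF rank_sorted_distinct[OF rank_sorted_rank_list]] set_rank_list by metis

text \<open>Ball b is given entry b of the concatenation, found at index b - 1. The labels of move
  \<open>Suc i\<close> form the interval after the first i segments and so recover segment
  \<open>Ls ! i\<close>.\<close>

lemma map_labels_concat:
  assumes "p = map length Ls" "i < length Ls"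
  shows "map (\<lambda>b. concat Ls ! (b - 1)) (labels p (Suc i)) = Ls ! i"
proof (rule nth_equalityI)
  let ?s = "sum_list (take i p)"
  have s: "length (concat (take i Ls)) = ?s" using assms(1) by (simp add: length_concat take_map)
  have split: "concat Ls = concat (take i Ls) @ Ls ! i @ concat (drop (Suc i) Ls)"
    using id_take_nth_drop[OF assms(2)] by (metis concat.simps(2) concat_append)
  have Suc: "sum_list (take (Suc i) p) = ?s + length (Ls ! i)"
    using assms by (simp add: sum_list_take_Suc)
  show "length (map (\<lambda>b. concat Ls ! (b - 1)) (labels p (Suc i))) = length (Ls ! i)"
    unfolding labels_def length_map length_upt Suc by simp
  fix k assume "k < length (map (\<lambda>b. concat Ls ! (b - 1)) (labels p (Suc i)))"
  then have k: "k < length (Ls ! i)" unfolding labels_def length_map length_upt Suc by simp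
  then have "labels p (Suc i) ! k = ?s + 1 + k"
    unfolding labels_def Suc by (subst nth_upt) simp_all
  moreover have "k < length (labels p (Suc i))"
    using k unfolding labels_def length_upt Suc by simp
  ultimately show "map (\<lambda>b. concat Ls ! (b - 1)) (labels p (Suc i)) ! k = Ls ! i ! k"
    using k by (simp add: split nth_append flip: s)
qed

text \<open>The times in a block are handed out to the balls of the corresponding move so that the deque
  shows its future output times in rank order; separatedness preserves this order under insertion,
  and so the ball leaving in the i-th move is the one that was assigned the time i.\<close>

lemma blocks_of_separated:
  assumes part: "partition_on {1..length \<chi>} \<rho>" and sep: "separated \<chi> \<rho>"
  obtains p where "admissible (length \<chi>) p" "blocks \<chi> p = \<rho>"
proof -
  let ?n = "length \<chi>"
  \<comment> \<open>\<open>B i\<close> is the block with minimum \<open>i\<close>, and empty if no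
    block has this minimum.\<close>
  define B where "B i = {t. \<exists>V\<in>\<rho>. Min V = i \<and> t \<in> V}" for i
  note pb = partition_on_block[OF part]
  have B_le: "i \<le> t" and B_in: "t \<in> {1..?n}" if "t \<in> B i" for t i
    using that pb(3,5) unfolding B_def by blast+
  have B_sub: "B i \<subseteq> {1..?n}" for i using B_in by blast
  then have fin: "finite (B i)" for i by (meson finite_atLeastAtMost finite_subset)
  have B_disj: "i = j" if "t \<in> B i" "t \<in> B j" for t i j
    using that partition_on_same_block[OF part] unfolding B_def by blast
  have B_cover: "\<exists>i\<in>{1..t}. t \<in> B i" if t: "t \<in> {1..?n}" for t
  proof -
    obtain V where V: "V \<in> \<rho>" "t \<in> V" using t unfolding partition_onD1[OF part] by (rule UnionE)
    then have "t \<in> B (Min V)" unfolding B_def by blast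
    moreover have "Min V \<in> {1..t}" using pb(3,4,5)[OF V(1)] V(2) by fastforce
    ultimately show ?thesis by blast
  qed
  have B_Min: "B (Min V) = V" if V: "V \<in> \<rho>" for V
  proof (intro equalityI subsetI)
    fix t assume "t \<in> B (Min V)"
    then obtain W where W: "W \<in> \<rho>" "Min W = Min V" "t \<in> W" unfolding B_def by blast
    have "W = V"
      using partition_on_same_block[OF part W(1) V pb(4)[OF W(1)]] pb(4)[OF V] W(2) by simp
    with W show "t \<in> V" by simp
  qed (use V B_def in blast)
  have B_block: "B i \<in> \<rho>" "Min (B i) = i" "i \<in> B i" if ne: "B i \<noteq> {}" for i
  proof -
    obtain V where V: "V \<in> \<rho>" "Min V = i" using ne unfolding B_def by blast
    then have "B i = V" using B_Min by blast
    with V pb(4)[OF V(1)] show "B i \<in> \<rho>" "Min (B i) = i" "i \<in> B i" by auto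
  qed

  \<comment> \<open>Successive insertion on the left reverses the labels. Reversing the list
    beforehand makes the deque show increasing ranks on either side.\<close>
  define L where "L i = (if \<chi> ! (i - 1) = Left_end then rev (rank_list \<chi> (B i)) else rank_list \<chi> (B i))"
    for i
  define Ls where "Ls = map L [1..<Suc ?n]"
  define p where "p = map length Ls"
  have Ls: "length Ls = ?n" "\<And>i. i < ?n \<Longrightarrow> Ls ! i = L (Suc i)"
    by (simp_all add: Ls_def del: upt_Suc)
  have len_p: "length p = ?n" by (simp add: p_def Ls)
  have set_L: "set (L i) = B i" for i by (simp add: L_def set_rank_list[OF B_sub])
  have p_nth: "p ! i = card (B (Suc i))" if "i < ?n" for i
    using that by (simp add: p_def Ls L_def length_rank_list[OF B_sub])
  have sum_p: "sum_list (take i p) = card (\<Union>j\<in>{1..i}. B j)" if "i \<le> ?n" for i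
    using that
  proof (induction i)
    case (Suc i)
    have "(\<Union>j\<in>{1..i}. B j) \<inter> B (Suc i) = {}" using B_disj by fastforce
    moreover have "(\<Union>j\<in>{1..Suc i}. B j) = (\<Union>j\<in>{1..i}. B j) \<union> B (Suc i)"
      by (auto simp: atLeastAtMostSuc_conv)
    ultimately have "card (\<Union>j\<in>{1..Suc i}. B j) = card (\<Union>j\<in>{1..i}. B j) + card (B (Suc i))"
      using fin by (simp add: card_Un_disjoint)
    then show ?case using Suc by (simp add: sum_list_take_Suc len_p p_nth)
  qed simp
  have UB: "(\<Union>j\<in>{1..?n}. B j) = {1..?n}"
    using B_sub B_cover by fastforce
  have adm: "admissible ?n p"
    unfolding admissible_def
  proof (intro conjI allI impI)
    show "length p = ?n" by (rule len_p)
    show "sum_list p = ?n" using sum_p[OF order_refl] unfolding UB by (simp add: len_p)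
    fix i assume i: "i \<le> ?n"
    \<comment> \<open>The block of a time \<open>t\<close> has minimum at most \<open>t\<close>, so
      the blocks inserted in the first \<open>i\<close> moves cover all times up to
      \<open>i\<close>; this is the prefix condition.\<close>
    have "{1..i} \<subseteq> (\<Union>j\<in>{1..i}. B j)"
    proof
      fix t assume "t \<in> {1..i}"
      then show "t \<in> (\<Union>j\<in>{1..i}. B j)" using B_cover[of t] i by fastforce
    qed
    then have "card {1..i} \<le> card (\<Union>j\<in>{1..i}. B j)" using fin by (intro card_mono) auto
    then show "i \<le> sum_list (take i p)" using sum_p[OF i] by simp
  qed

  \<comment> \<open>\<open>out\<close> is the time assigned to a ball; that the ball really leaves
    at this time is shown by the simulation below.\<close>
  define out where "out b = concat Ls ! (b - 1)" for b
  have out_labels: "map out (labels p (Suc i)) = L (Suc i)" if "i < ?n" for i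
    using map_labels_concat[OF p_def, of i] that Ls unfolding out_def by simp

  \<comment> \<open>The invariant of the run: the deque shows, in rank order, the assigned times
    still to come of the blocks inserted so far, and all earlier removals took place at their
    assigned times.\<close>
  have sim: "rank_sorted \<chi> (map out (deque \<chi> p i)) \<and>
      out ` set (deque \<chi> p i) = {t. i < t \<and> (\<exists>j\<in>{1..i}. t \<in> B j)} \<and>
      (\<forall>t\<in>{1..i}. out (removed_ball \<chi> p t) = t)" if "i \<le> ?n" for i
    using that
  proof (induction i)
    case 0
    then show ?case by (simp add: rank_sorted_Nil)
  next
    case (Suc i)
    define D where "D = insert_phase \<chi> p (Suc i) (deque \<chi> p i)"
    from Suc have i: "i < ?n" and sorted: "rank_sorted \<chi> (map out (deque \<chi> p i))"
      and set: "out ` set (deque \<chi> p i) = {t. i < t \<and> (\<exists>j\<in>{1..i}. t \<in> B j)}"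
      and removed: "\<forall>t\<in>{1..i}. out (removed_ball \<chi> p t) = t" by auto
    \<comment> \<open>A waiting time \<open>w\<close> is later than \<open>i\<close> and, by
      disjointness, not the minimum \<open>Suc i\<close> of the new block, so separation applies to
      it.\<close>
    have before: "if \<chi> ! i = Left_end then rank \<chi> v < rank \<chi> w else rank \<chi> w < rank \<chi> v"
      if v: "v \<in> B (Suc i)" and w: "w \<in> out ` set (deque \<chi> p i)" for v w
    proof -
      obtain j where j: "j \<le> i" "w \<in> B j" "i < w" using w set by auto
      have b: "B (Suc i) \<in> \<rho>" "Min (B (Suc i)) = Suc i" "Suc i \<in> B (Suc i)"
        using B_block[of "Suc i"] v by auto
      have c: "B j \<in> \<rho>" "Min (B j) = j" using B_block[of j] j by auto
      have "w \<noteq> Suc i" using B_disj[OF j(2), of "Suc i"] b(3) j(1) by auto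
      then have "Suc i < w" using j by simp
      then have "if \<chi> ! (Suc i - 1) = Left_end then rank \<chi> v < rank \<chi> w else rank \<chi> w < rank \<chi> v"
        using sep[unfolded separated_def, rule_format, OF b(1) c(1) _ v j(2)] b(2) c(2) j(1) by simp
      then show ?thesis by simp
    qed
    have map_D: "map out D = (if \<chi> ! i = Left_end then rank_list \<chi> (B (Suc i)) @ map out (deque \<chi> p i)
        else map out (deque \<chi> p i) @ rank_list \<chi> (B (Suc i)))"
      using out_labels[OF i] by (simp add: D_def insert_phase_eq L_def flip: rev_map)
    have sorted_D: "rank_sorted \<chi> (map out D)"
      using before sorted rank_sorted_rank_list unfolding map_D
      by (auto simp: rank_sorted_append set_rank_list[OF B_sub])
    have "out ` set D = B (Suc i) \<union> {t. i < t \<and> (\<exists>j\<in>{1..i}. t \<in> B j)}"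
      using arg_cong[OF map_D, of set] set set_rank_list[OF B_sub] by (auto split: if_splits)
    also have "\<dots> = {t. i < t \<and> (\<exists>j\<in>{1..Suc i}. t \<in> B j)}"
      using B_le by (fastforce simp: atLeastAtMostSuc_conv)
    finally have set_D: "out ` set D = {t. i < t \<and> (\<exists>j\<in>{1..Suc i}. t \<in> B j)}" .
    define r where "r = out (removed_ball \<chi> p (Suc i))"
    define E where "E = map out (deque \<chi> p (Suc i))"
    have "D \<noteq> []" unfolding D_def by (rule insert_phase_not_Nil[OF adm i])
    from arg_cong[OF end_ball_remove_end[OF this, of "\<chi> ! i"], of "map out"]
    have split: "map out D = (if \<chi> ! i = Left_end then r # E else E @ [r])"
      unfolding D_def removed_ball_Suc[symmetric] deque.simps(2)[symmetric] r_def E_def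
      by (simp split: if_splits)
    have set_E: "insert r (set E) = {t. i < t \<and> (\<exists>j\<in>{1..Suc i}. t \<in> B j)}"
      using arg_cong[OF split, of set] set_D by (simp split: if_splits)
    have sorted_E: "rank_sorted \<chi> E"
      and r_E: "\<forall>t\<in>set E. if \<chi> ! i = Left_end then rank \<chi> r < rank \<chi> t else rank \<chi> t < rank \<chi> r"
      using sorted_D unfolding split
      by (auto simp: rank_sorted_append rank_sorted_Cons split: if_splits)
    \<comment> \<open>Otherwise both would be strictly extremal in rank on the side of the removal:
      \<open>r\<close> as the end of the sorted deque, \<open>Suc i\<close> as the earliest time
      present.\<close>
    have "r = Suc i"
    proof (rule ccontr)
      assume ne: "r \<noteq> Suc i"
      have "Suc i \<in> insert r (set E)"
        unfolding set_E using B_cover[of "Suc i"] i by auto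
      then have "Suc i \<in> set E" using ne by simp
      with r_E have "if \<chi> ! i = Left_end then rank \<chi> r < rank \<chi> (Suc i) else rank \<chi> (Suc i) < rank \<chi> r"
        by blast
      moreover have "r \<in> {t. i < t \<and> (\<exists>j\<in>{1..Suc i}. t \<in> B j)}"
        using set_E by (rule subst) simp
      then have "i < r" "r \<le> ?n" using B_in[of r] by auto
      ultimately show False
        using rank_less_iff[of "Suc i" r \<chi>] ne by (auto split: if_splits)
    qed
    have "r \<notin> set E" using r_E by (auto split: if_splits)
    then have "set E = insert r (set E) - {Suc i}" using \<open>r = Suc i\<close> by simp
    also have "\<dots> = {t. Suc i < t \<and> (\<exists>j\<in>{1..Suc i}. t \<in> B j)}" unfolding set_E by auto
    finally have "set E = {t. Suc i < t \<and> (\<exists>j\<in>{1..Suc i}. t \<in> B j)}" .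
    moreover have "\<forall>t\<in>{1..Suc i}. out (removed_ball \<chi> p t) = t"
      using removed \<open>r = Suc i\<close> unfolding r_def by (auto simp: atLeastAtMostSuc_conv)
    ultimately show ?case using sorted_E unfolding E_def by simp
  qed
  have out_removed: "out (removed_ball \<chi> p t) = t" if "t \<in> {1..?n}" for t
    using sim[OF order_refl] that by blast

  have in_B: "t \<in> B i"
    if "t \<in> {1..?n}" "removed_ball \<chi> p t \<in> set (labels p i)" "1 \<le> i" "i \<le> ?n" for t i
  proof -
    have "map out (labels p i) = L i" using out_labels[of "i - 1"] that by simp
    then have "out ` set (labels p i) = B i" by (metis set_L list.set_map)
    then show ?thesis using out_removed[OF that(1)] that(2) by force
  qed
  have output_block: "output_block \<chi> p i = B i" if i: "1 \<le> i" "i \<le> ?n" for i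
  proof (intro equalityI subsetI)
    fix t assume "t \<in> output_block \<chi> p i"
    then show "t \<in> B i" using in_B i by (auto simp: output_block_def has_output_time_def)
  next
    fix t assume t: "t \<in> B i"
    then have t': "t \<in> {1..?n}" by (rule B_in)
    then have "1 \<le> removed_ball \<chi> p t" "removed_ball \<chi> p t \<le> sum_list p"
      using removed_ball_in[OF adm t'] adm by (auto simp: admissible_def)
    then obtain j where j: "1 \<le> j" "j \<le> length p" "removed_ball \<chi> p t \<in> set (labels p j)"
      by (rule ball_in_labels)
    \<comment> \<open>The ball leaving at \<open>t\<close> comes from some move \<open>j\<close>, so
      its assigned time \<open>t\<close> lies in \<open>B j\<close> as well as in
      \<open>B i\<close>.\<close>
    then have "j = i" using in_B[OF t' j(3)] B_disj t len_p by metis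
    with j t' show "t \<in> output_block \<chi> p i"
      by (auto simp: output_block_def has_output_time_def)
  qed
  have "blocks \<chi> p = {B i | i. 1 \<le> i \<and> i \<le> ?n \<and> B i \<noteq> {}}"
  proof -
    have "p ! (i - 1) > 0 \<longleftrightarrow> B i \<noteq> {}" if "1 \<le> i" "i \<le> ?n" for i
      using p_nth[of "i - 1"] that fin by (simp add: card_gt_0_iff)
    then show ?thesis unfolding blocks_def using output_block by (metis (no_types, lifting))
  qed
  also have "\<dots> = \<rho>"
  proof (intro equalityI subsetI)
    fix V assume "V \<in> {B i | i. 1 \<le> i \<and> i \<le> ?n \<and> B i \<noteq> {}}"
    then show "V \<in> \<rho>" using B_block(1) by blast
  next
    fix V assume V: "V \<in> \<rho>"
    have "1 \<le> Min V" "Min V \<le> ?n" "B (Min V) \<noteq> {}"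
      using pb(2,3,4)[OF V] B_Min[OF V] by auto
    then show "V \<in> {B i | i. 1 \<le> i \<and> i \<le> ?n \<and> B i \<noteq> {}}"
      using B_Min[OF V, symmetric] by blast
  qed
  finally show ?thesis using that adm by blast
qed

theorem theorem4p10:
  fixes n :: nat and \<chi> :: "side list"
  assumes "n \<ge> 1" and "length \<chi> = n"
  shows "output_time_partitions \<chi> = {act (sigma \<chi>) \<pi> | \<pi>. \<pi> \<in> NC n}"
proof -
  have Phi: "Phi \<chi> lam = blocks \<chi> (insertions lam)" for lam
    by (simp add: Phi_def blocks_def Let_def)
  \<comment> \<open>Both sides of the theorem are identified with the set of separated
    partitions.\<close>
  have "output_time_partitions \<chi> = {\<rho>. partition_on {1..length \<chi>} \<rho> \<and> separated \<chi> \<rho>}"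
  proof (intro equalityI subsetI)
    fix \<rho> assume "\<rho> \<in> output_time_partitions \<chi>"
    then obtain lam where "lam \<in> Luk (length \<chi>)" "\<rho> = blocks \<chi> (insertions lam)"
      unfolding output_time_partitions_def Phi by blast
    then show "\<rho> \<in> {\<rho>. partition_on {1..length \<chi>} \<rho> \<and> separated \<chi> \<rho>}"
      using partition_on_blocks separated_blocks admissible_insertions by blast
  next
    fix \<rho> assume "\<rho> \<in> {\<rho>. partition_on {1..length \<chi>} \<rho> \<and> separated \<chi> \<rho>}"
    then obtain p where p: "admissible (length \<chi>) p" "blocks \<chi> p = \<rho>"
      using blocks_of_separated by blast
    obtain lam where "lam \<in> Luk (length \<chi>)" "insertions lam = p"
      using Luk_of_admissible[OF p(1)] .
    with p(2) show "\<rho> \<in> output_time_partitions \<chi>"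
      unfolding output_time_partitions_def Phi by blast
  qed
  then show ?thesis using act_sigma_NC[of \<chi>] assms(2) by simp
qed

end
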